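(* Let $\alpha\in\mathbb{R}^d_{++}$ with $\sum_{i\in[d]}\alpha_i=1$ and let $(p,r)$, with $p\in\mathbb{R}^d$ and $r\in\mathbb{R}$, be in the interior of $\mathcal{K}_{\mathrm{powm}(\alpha,d)}$. The corresponding primal conjugate gradient $g_{(p,r)}=(g_p,g_r)$ (of the dual barrier $f^*_{\mathrm{powm}}$) can be obtained via $$g_{p_i}=-\frac1{p_i}-\frac{\alpha_i}{p_i}(1+r\,g_r),\quad i\in[d],$$ where $g_r$ can be computed numerically depending on the sign of $r$: 1. If $r>0$, then $g_r=1/\hat x$, where $\hat x$ is the root of $$h(x)=\sum_{i\in[d]}\alpha_i\ln\Big(\frac{1+\alpha_i}{\alpha_ip_i}\cdot x+\frac r{p_i}\Big)-\ln\Big(1+\frac{1}{r+x}\Big).$$ The root of $h(x)$ can be computed via the one-dimensional Newton–Raphson method, which converges quadratically if started from $x_0=0$. 2. If $r<0$, then $g_r=\big(\varphi-\sqrt{\varphi^2+4/r^2}\big)/2-1/r$, where $\varphi=1/\hat x$ and $\hat x$ is the root of $$h(x)=\sum_{i\in[d]}\alpha_i\ln\Big(\frac{x}{\alpha_ip_i}+\frac{r+\sqrt{r^2+4x^2}}{2p_i}\Big).$$ The root of $h(x)$ can be computed via the one-dimensional Newton–Raphson method, which converges quadratically if started from $x_0=\prod_{i\in[d]}\big(\frac{\alpha_ip_i}{1+\alpha_i}\big)^{\alpha_i}$. 3. If $r=0$, then $g_{p_i}=-\frac1{p_i}-\frac{\alpha_i}{p_i}$ for $i\in[d]$ and $g_r=\varphi(-g_p)/2$,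 where $\varphi(u)=\prod_{i\in[d]}(u_i/\alpha_i)^{\alpha_i}$.
   Context: $[d]=\{1,\dots,d\}$; $\mathbb{R}^d_+$, $\mathbb{R}^d_{++}$ are the vectors with nonnegative, resp. positive, entries; $\mathbb{R}_-$ is the set of nonpositive reals. Cones: the power mean cone is $\mathcal{K}_{\mathrm{powm}(\alpha,d)}=\{(u,w)\in\mathbb{R}^d_+\times\mathbb{R}:\prod_{i\in[d]}u_i^{\alpha_i}\ge w\}$, with dual cone $\mathcal{K}^*_{\mathrm{powm}(\alpha,d)}=\{(u,w)\in\mathbb{R}^d_+\times\mathbb{R}_-:\prod_{i\in[d]}(u_i/\alpha_i)^{\alpha_i}\ge-w\}$. Dual barrier, on the interior of $\mathcal{K}^*_{\mathrm{powm}(\alpha,d)}$: $f^*_{\mathrm{powm}}(u,w)=-\ln\big(\prod_{i\in[d]}(u_i/\alpha_i)^{\alpha_i}+w\big)-\sum_{i\in[d]}(1-\alpha_i)\ln(u_i/\alpha_i)-\ln(-w)$, with gradient $g^*=\nabla f^*_{\mathrm{powm}}$. Primal conjugate gradient: for $s$ in the interior of the primal cone $\mathcal{K}$, $g_s=-\arg\max_{y\in\mathrm{int}\,\mathcal{K}^*}\{-\langle s,y\rangle-f^*(y)\}$; equivalently, $g_s$ is the vector with $-g_s\in\mathrm{int}\,\mathcal{K}^*$ and $-g^*(-g_s)=s$.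
   Formalization: In case r>0 the last term of h is −ln(1+x/(r+x)) instead of the printed −ln(1+1/(r+x)); with the printed term g_r=1/x̂ fails, e.g. for d=1, α=1, p=4, r=1, where g_r=1/3 but the printed h(3)=ln(7/4)−ln(5/4)≠0. *)

theory Defs
  imports "HOL-Analysis.Analysis"
begin

definition conj_grad_objective :: "('a::euclidean_space \<Rightarrow> real) \<Rightarrow> 'a \<Rightarrow> 'a \<Rightarrow> real" where
  "conj_grad_objective fd s y = - (s \<bullet> y) - fd y"

(* Kd is the dual cone and fd its barrier; fd is only evaluated on the interior of Kd.
   This is meaningful only where the maximizer exists and is unique. *)
definition primal_conj_grad ::
    "('a::euclidean_space) set \<Rightarrow> ('a \<Rightarrow> real) \<Rightarrow> 'a \<Rightarrow> 'a" where
  "primal_conj_grad Kd fd s = - arg_max_on (conj_grad_objective fd s) (interior Kd)"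

definition powm_cone :: "real^'n \<Rightarrow> ((real^'n) \<times> real) set" where
  "powm_cone \<alpha> = {(u, w). (\<forall>i. 0 \<le> u $ i) \<and> (\<Prod>i\<in>UNIV. (u $ i) powr (\<alpha> $ i)) \<ge> w}"

definition powm_phi :: "real^'n \<Rightarrow> real^'n \<Rightarrow> real" where
  "powm_phi \<alpha> u = (\<Prod>i\<in>UNIV. (u $ i / \<alpha> $ i) powr (\<alpha> $ i))"

definition powm_dual_cone :: "real^'n \<Rightarrow> ((real^'n) \<times> real) set" where
  "powm_dual_cone \<alpha> = {(u, w). (\<forall>i. 0 \<le> u $ i) \<and> w \<le> 0 \<and> powm_phi \<alpha> u \<ge> - w}"

definition powm_dual_barrier :: "real^'n \<Rightarrow> (real^'n) \<times> real \<Rightarrow> real" where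
  "powm_dual_barrier \<alpha> = (\<lambda>(u, w).
     - ln (powm_phi \<alpha> u + w) - (\<Sum>i\<in>UNIV. (1 - \<alpha> $ i) * ln (u $ i / \<alpha> $ i)) - ln (- w))"

(* The case r > 0.  At a conjugate gradient (g_p, g_r), stationarity in the last coordinate reads
   r = 1 / (phi - g_r) - 1 / g_r with phi = powm_phi \<alpha> (- g_p).  Writing g_r = 1 / x this is
   x * phi = 1 + x / (r + x).  The last logarithm is sometimes printed with 1 / (r + x)
   instead of x / (r + x); the root of that function is in general not 1 / g_r
   (one coordinate, \<alpha> = 1, p = 4, r = 1: here x = 3). *)
definition powm_h_pos :: "real^'n \<Rightarrow> real^'n \<Rightarrow> real \<Rightarrow> real \<Rightarrow> real" where
  "powm_h_pos \<alpha> p r x =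
     (\<Sum>i\<in>UNIV. \<alpha> $ i * ln ((1 + \<alpha> $ i) / (\<alpha> $ i * p $ i) * x + r / p $ i))
     - ln (1 + x / (r + x))"

(* HOL functions are total, so the natural domains of powm_h_pos and powm_h_neg (no division
   by zero, positive arguments of ln) are stated separately. *)
definition powm_h_pos_dom :: "real^'n \<Rightarrow> real^'n \<Rightarrow> real \<Rightarrow> real set" where
  "powm_h_pos_dom \<alpha> p r =
     {x. (\<forall>i. 0 < (1 + \<alpha> $ i) / (\<alpha> $ i * p $ i) * x + r / p $ i)
         \<and> r + x \<noteq> 0 \<and> 0 < 1 + x / (r + x)}"

definition powm_h_neg :: "real^'n \<Rightarrow> real^'n \<Rightarrow> real \<Rightarrow> real \<Rightarrow> real" where
  "powm_h_neg \<alpha> p r x =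
     (\<Sum>i\<in>UNIV. \<alpha> $ i *
        ln (x / (\<alpha> $ i * p $ i) + (r + sqrt (r\<^sup>2 + 4 * x\<^sup>2)) / (2 * p $ i)))"

definition powm_h_neg_dom :: "real^'n \<Rightarrow> real^'n \<Rightarrow> real \<Rightarrow> real set" where
  "powm_h_neg_dom \<alpha> p r =
     {x. \<forall>i. 0 < x / (\<alpha> $ i * p $ i) + (r + sqrt (r\<^sup>2 + 4 * x\<^sup>2)) / (2 * p $ i)}"

definition newton_seq :: "(real \<Rightarrow> real) \<Rightarrow> real \<Rightarrow> nat \<Rightarrow> real" where
  "newton_seq h x0 n = ((\<lambda>x. x - h x / deriv h x) ^^ n) x0"

(* The first conjunct says that every Newton step is well defined. *)
definition newton_converges_quadratically ::
    "(real \<Rightarrow> real) \<Rightarrow> real set \<Rightarrow> real \<Rightarrow> real \<Rightarrow> bool" where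
  "newton_converges_quadratically h D x0 z \<longleftrightarrow>
     (\<forall>n. newton_seq h x0 n \<in> D \<and> h field_differentiable at (newton_seq h x0 n)
          \<and> deriv h (newton_seq h x0 n) \<noteq> 0)
     \<and> newton_seq h x0 \<longlonglongrightarrow> z
     \<and> (\<exists>C. \<forall>n. \<bar>newton_seq h x0 (Suc n) - z\<bar> \<le> C * \<bar>newton_seq h x0 n - z\<bar>\<^sup>2)"

end

theory Submission
  imports Defs
begin

text \<open>
  An interior point \<open>(u, w) = (- gp, - gr)\<close> of the dual cone is a stationary point of the objective exactly if
  \<open>p i * u i = 1 + \<alpha> i * (1 + r * gr)\<close> for all \<open>i\<close> and \<open>r = 1 / (\<phi> - gr) - 1 / gr\<close>, where
  \<open>\<phi> = powm_phi \<alpha> u\<close>. The first equation is the formula for \<open>gp\<close>. Substituted into \<open>\<phi>\<close>, it leaves one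
  equation in one unknown: with \<open>gr = 1 / x\<close> if \<open>r > 0\<close>, and with \<open>\<phi> = 1 / x\<close> and the second equation
  solved for \<open>gr\<close> if \<open>r < 0\<close>, its logarithm is \<open>h x = 0\<close>. If \<open>r = 0\<close> it just says \<open>\<phi> = 2 * gr\<close>.

  It therefore suffices to produce, from a root of \<open>h\<close>, a point that satisfies the two equations, and to know
  that such a point is the unique maximiser. The latter (\<open>stationary_point_strict_max\<close>) follows from two
  inequalities: after rescaling, the difference of two objective values is a sum of terms \<open>x - 1 - ln x\<close> and of one gap between a
  weighted arithmetic and a geometric mean. Existence and uniqueness of the maximiser and the formulas for it
  then come together (\<open>primal_conj_grad_powmI\<close>).

  The statements on Newton's method rest on the fact that \<open>h\<close> is strictly increasing and concave on its whole
  domain, an interval unbounded above. For such a function the tangent at a point left of the root has its zero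
  between that point and the root, so the iteration climbs monotonically and the error of a step is controlled by
  the variation of the derivative (\<open>newton_concave_from_left\<close>). The two prescribed starting points are left of the
  root. Monotonicity and concavity are elementary but not automatic: for \<open>r > 0\<close> the term \<open>- ln (1 + x / (r + x))\<close>
  is convex and decreasing, and is compensated because \<open>\<alpha> i / (1 + \<alpha> i) \<le> 1/2\<close> (\<open>powm_h_pos_newton\<close>); for
  \<open>r < 0\<close> the arguments of the logarithms are convex, but not enough to outweigh the logarithm (\<open>powm_h_neg_newton\<close>).
\<close>

section \<open>Weighted means\<close>

lemma weight_le_one:
  fixes \<alpha> :: "real^'n"
  assumes "\<forall>i. 0 < \<alpha> $ i" and "(\<Sum>i\<in>UNIV. \<alpha> $ i) = 1"
  shows "\<alpha> $ i \<le> 1"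
  using member_le_sum[of i UNIV "\<lambda>i. \<alpha> $ i"] assms by (simp add: less_imp_le)

lemma prod_powr_eq_exp:
  fixes c a :: "'i \<Rightarrow> real"
  assumes "finite I" "\<And>i. i \<in> I \<Longrightarrow> 0 < c i"
  shows "(\<Prod>i\<in>I. c i powr a i) = exp (\<Sum>i\<in>I. a i * ln (c i))"
  using assms by (simp add: exp_sum powr_def less_imp_neq[symmetric] cong: prod.cong)

lemma weighted_sum_ln_scale:
  fixes a c :: "'i \<Rightarrow> real"
  assumes "sum a I = 1" "0 < x" "\<And>i. i \<in> I \<Longrightarrow> 0 < c i"
  shows "(\<Sum>i\<in>I. a i * ln (x * c i)) = ln x + (\<Sum>i\<in>I. a i * ln (c i))"
proof -
  have "(\<Sum>i\<in>I. a i * ln (x * c i)) = (\<Sum>i\<in>I. a i * ln x + a i * ln (c i))"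
    using assms by (intro sum.cong refl) (simp add: ln_mult_pos distrib_left)
  also have "\<dots> = sum a I * ln x + (\<Sum>i\<in>I. a i * ln (c i))"
    by (simp add: sum.distrib sum_distrib_right)
  finally show ?thesis using assms(1) by simp
qed

text \<open>
  Summing \<open>ln (t i / A) \<le> t i / A - 1\<close>, where \<open>A\<close> is the arithmetic mean, makes the right-hand side vanish.
\<close>

lemma weighted_geometric_le_arithmetic_mean:
  fixes a t :: "'i \<Rightarrow> real"
  assumes "finite I" and nn: "\<And>i. i \<in> I \<Longrightarrow> 0 \<le> a i" and sum1: "sum a I = 1"
    and pos: "\<And>i. i \<in> I \<Longrightarrow> 0 < t i"
  shows "exp (\<Sum>i\<in>I. a i * ln (t i)) \<le> (\<Sum>i\<in>I. a i * t i)"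
proof -
  define A where "A = (\<Sum>i\<in>I. a i * t i)"
  obtain j where "j \<in> I" "0 < a j"
    using sum1 nn by (metis less_le sum.neutral zero_neq_one)
  then have "0 < A"
    unfolding A_def using nn[of j] pos[of j] nn pos
    by (intro sum_pos2[OF \<open>finite I\<close>, of j]) (auto simp: less_imp_le)
  have "a i * ln (t i) \<le> a i * (ln A + (t i / A - 1))" if "i \<in> I" for i
    using ln_le_minus_one[of "t i / A"] pos[OF that] nn[OF that] \<open>0 < A\<close>
    by (intro mult_left_mono) (auto simp: ln_div)
  then have "(\<Sum>i\<in>I. a i * ln (t i)) \<le> (\<Sum>i\<in>I. a i * (ln A + (t i / A - 1)))"
    by (rule sum_mono)
  also have "\<dots> = (\<Sum>i\<in>I. a i * (ln A - 1) + a i * t i / A)"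
    by (simp add: algebra_simps)
  also have "\<dots> = sum a I * (ln A - 1) + A / A"
    by (simp only: sum.distrib sum_distrib_right sum_divide_distrib[symmetric] A_def)
  also have "\<dots> = ln A"
    using sum1 \<open>0 < A\<close> by simp
  finally show ?thesis
    using \<open>0 < A\<close> unfolding A_def by (metis exp_le_cancel_iff exp_ln)
qed

lemma powm_phi_eq_exp:
  fixes \<alpha> u :: "real^'n"
  assumes "\<forall>i. 0 < \<alpha> $ i" "\<forall>i. 0 < u $ i"
  shows "powm_phi \<alpha> u = exp (\<Sum>i\<in>UNIV. \<alpha> $ i * ln (u $ i / \<alpha> $ i))"
proof -
  have "(u $ i / \<alpha> $ i) powr (\<alpha> $ i) = exp (\<alpha> $ i * ln (u $ i / \<alpha> $ i))" for i
    using assms[rule_format, of i] by (simp add: powr_def)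
  then show ?thesis unfolding powm_phi_def by (simp add: exp_sum)
qed

text \<open>
  The form in which a root of \<open>h\<close> becomes a value of \<open>powm_phi\<close>: the arguments of the logarithms in \<open>h\<close>
  are \<open>x * (v $ i / \<alpha> $ i)\<close> for the point \<open>v\<close> to be constructed.
\<close>

lemma powm_phi_scale:
  fixes \<alpha> v :: "real^'n"
  assumes \<alpha>: "\<forall>i. 0 < \<alpha> $ i" and sum\<alpha>: "(\<Sum>i\<in>UNIV. \<alpha> $ i) = 1"
    and v: "\<And>i. 0 < v $ i" and x: "0 < x"
  shows "x * powm_phi \<alpha> v = exp (\<Sum>i\<in>UNIV. \<alpha> $ i * ln (x * (v $ i / \<alpha> $ i)))"
  using weighted_sum_ln_scale[OF sum\<alpha> x, of "\<lambda>i. v $ i / \<alpha> $ i"] \<alpha> v x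
  by (simp add: powm_phi_eq_exp exp_add)

section \<open>Interiors of the power mean cone and its dual\<close>

lemma interior_powm_coneD:
  fixes \<alpha> p :: "real^'n"
  assumes "(p, r) \<in> interior (powm_cone \<alpha>)"
  shows "0 < p $ i" and "r < (\<Prod>i\<in>UNIV. (p $ i) powr (\<alpha> $ i))"
proof -
  obtain e where e: "0 < e" "cball (p, r) e \<subseteq> powm_cone \<alpha>"
    using assms unfolding mem_interior_cball by blast
  have "(p - e *\<^sub>R axis i 1, r) \<in> powm_cone \<alpha>"
    using e by (intro subsetD[OF e(2)]) (simp add: dist_Pair_Pair dist_norm)
  then have "0 \<le> (p - e *\<^sub>R axis i 1) $ i"
    unfolding powm_cone_def by blast
  then show "0 < p $ i"
    using e(1) by simp
  have "(p, r + e) \<in> powm_cone \<alpha>"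
    using e by (intro subsetD[OF e(2)]) (simp add: dist_Pair_Pair dist_norm)
  then show "r < (\<Prod>i\<in>UNIV. (p $ i) powr (\<alpha> $ i))"
    using e(1) unfolding powm_cone_def by auto
qed

text \<open>
  A small step down in a coordinate of \<open>u\<close>, or in either direction in \<open>w\<close>, stays in the cone and turns each
  weak inequality into a strict one; conversely, the strict inequalities define an open set because
  \<open>powm_phi\<close> is continuous where all coordinates are positive.
\<close>

lemma interior_powm_dual_cone:
  fixes \<alpha> :: "real^'n"
  assumes \<alpha>: "\<forall>i. 0 < \<alpha> $ i"
  shows "interior (powm_dual_cone \<alpha>) = {(u, w). (\<forall>i. 0 < u $ i) \<and> w < 0 \<and> 0 < powm_phi \<alpha> u + w}"
    (is "_ = ?S")
proof
  show "interior (powm_dual_cone \<alpha>) \<subseteq> ?S"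
  proof clarify
    fix u w assume "(u, w) \<in> interior (powm_dual_cone \<alpha>)"
    then obtain e where e: "0 < e" "cball (u, w) e \<subseteq> powm_dual_cone \<alpha>"
      unfolding mem_interior_cball by blast
    have "(u - e *\<^sub>R axis i 1, w) \<in> powm_dual_cone \<alpha>" for i
      using e by (intro subsetD[OF e(2)]) (simp add: dist_Pair_Pair dist_norm)
    then have "0 \<le> (u - e *\<^sub>R axis i 1) $ i" for i
      unfolding powm_dual_cone_def by blast
    then have "e \<le> u $ i" for i by simp
    then have "0 < u $ i" for i using e(1) by (metis less_le_trans)
    moreover have "(u, w + e) \<in> powm_dual_cone \<alpha>" "(u, w - e) \<in> powm_dual_cone \<alpha>"
      using e by (auto intro!: subsetD[OF e(2)] simp: dist_Pair_Pair dist_norm)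
    then have "w < 0" "0 < powm_phi \<alpha> u + w"
      using e(1) unfolding powm_dual_cone_def by auto
    ultimately show "(\<forall>i. 0 < u $ i) \<and> w < 0 \<and> 0 < powm_phi \<alpha> u + w" by blast
  qed
next
  define P where "P = {y :: (real^'n) \<times> real. \<forall>i. 0 < fst y $ i}"
  have "P = (\<Inter>i. {y. 0 < fst y $ i})" unfolding P_def by blast
  moreover have "open {y :: (real^'n) \<times> real. 0 < fst y $ i}" for i
    by (intro open_Collect_less continuous_intros)
  ultimately have "open P" by (metis open_INT finite_class.finite_UNIV)
  have cont: "continuous_on P (\<lambda>y. powm_phi \<alpha> (fst y) + snd y)"
    unfolding powm_phi_def P_def using \<alpha>
    by (intro continuous_intros) (auto simp: less_imp_neq [symmetric])
  have "?S = {y\<in>P. 0 < powm_phi \<alpha> (fst y) + snd y} \<inter> {y. snd y < 0}"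
    unfolding P_def by auto
  moreover have "open {y\<in>P. 0 < powm_phi \<alpha> (fst y) + snd y}"
    using continuous_open_preimage[OF cont \<open>open P\<close> open_greaterThan, of 0]
    by (simp add: vimage_def Collect_conj_eq)
  moreover have "open {y :: (real^'n) \<times> real. snd y < 0}"
    by (intro open_Collect_less continuous_intros)
  ultimately have "open ?S" by auto
  moreover have "?S \<subseteq> powm_dual_cone \<alpha>"
    unfolding powm_dual_cone_def by (auto simp: less_imp_le)
  ultimately show "?S \<subseteq> interior (powm_dual_cone \<alpha>)"
    by (rule interior_maximal[rotated])
qed

section \<open>A stationary point is the unique maximiser\<close>

text \<open>
  Write \<open>u i = v i * t i\<close> and \<open>w = - g * s\<close>. The logarithms of the objective become those of \<open>t i\<close>, \<open>s\<close> and of a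
  ratio \<open>q\<close>, and \<open>powm_phi\<close> is multiplied by the geometric mean \<open>G\<close> of \<open>t\<close>. By stationarity, the linear parts
  combine with the logarithms into gaps \<open>x - 1 - ln x\<close>, apart from a multiple of the difference between the
  arithmetic mean of \<open>t\<close> and \<open>G\<close>.
\<close>

lemma stationary_point_strict_max:
  fixes \<alpha> p v :: "real^'n" and r g :: real
  assumes \<alpha>: "\<forall>i. 0 < \<alpha> $ i" and sum\<alpha>: "(\<Sum>i\<in>UNIV. \<alpha> $ i) = 1"
    and v: "\<And>i. 0 < v $ i" and g: "0 < g" "g < powm_phi \<alpha> v"
    and stat_p: "\<And>i. p $ i * v $ i = 1 + \<alpha> $ i * (1 + r * g)"
    and stat_r: "r = 1 / (powm_phi \<alpha> v - g) - 1 / g"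
    and y: "y \<in> interior (powm_dual_cone \<alpha>)" "y \<noteq> (v, - g)"
  shows "conj_grad_objective (powm_dual_barrier \<alpha>) (p, r) y
       < conj_grad_objective (powm_dual_barrier \<alpha>) (p, r) (v, - g)"
proof -
  obtain u w where yuw: "y = (u, w)" by (cases y)
  have u: "\<And>i. 0 < u $ i" and w: "w < 0" "0 < powm_phi \<alpha> u + w"
    using y(1) unfolding interior_powm_dual_cone[OF \<alpha>] yuw by auto
  have \<alpha>1: "\<alpha> $ i \<le> 1" for i by (rule weight_le_one[OF \<alpha> sum\<alpha>])
  \<comment> \<open>the gap in \<open>ln x \<le> x - 1\<close>; it measures every loss except the one in the inequality of the means\<close>
  define e where "e = (\<lambda>x::real. x - 1 - ln x)"
  have e_nonneg: "0 \<le> e x" if "0 < x" for x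
    using ln_le_minus_one[OF that] by (simp add: e_def)
  have e_zero: "x = 1" if "e x = 0" "0 < x" for x
    using ln_eq_minus_one[of x] that by (simp add: e_def)
  define \<phi> where "\<phi> = powm_phi \<alpha> v"
  define z where "z = \<phi> - g"
  \<comment> \<open>the competitor, rescaled so that the stationary point becomes \<open>t = 1\<close>, \<open>s = 1\<close>\<close>
  define t where "t = (\<lambda>i. u $ i / v $ i)"
  define s where "s = w / (- g)"
  define G where "G = exp (\<Sum>i\<in>UNIV. \<alpha> $ i * ln (t i))"
  define q where "q = (powm_phi \<alpha> u + w) / z"
  have z: "0 < z" using g by (simp add: z_def \<phi>_def)
  have t: "0 < t i" for i using u v by (simp add: t_def)
  have s: "0 < s" using w(1) g by (simp add: s_def divide_neg_pos)
  have q: "0 < q" using w z by (simp add: q_def)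
  have "\<phi> > 0" using g by (simp add: \<phi>_def)
  have ut: "u $ i = v $ i * t i" for i using v[of i] by (simp add: t_def)
  have ws: "w = - g * s" using g by (simp add: s_def)
  have lnu: "ln (u $ i / \<alpha> $ i) = ln (v $ i / \<alpha> $ i) + ln (t i)" for i
    using v[of i] t[of i] \<alpha>[rule_format, of i] by (simp add: ut ln_div ln_mult)
  have phi_u: "powm_phi \<alpha> u = \<phi> * G"
    using \<alpha> u v by (simp add: powm_phi_eq_exp \<phi>_def G_def lnu distrib_left sum.distrib exp_add)
  have rg: "r * g = g / z - 1" using g z stat_r[folded \<phi>_def, folded z_def] by (simp add: field_simps)
  have "\<phi> / z = 2 + r * g" using z unfolding rg by (simp add: z_def field_simps)
  then have pv: "p $ i * v $ i = 1 - \<alpha> $ i + \<alpha> $ i * (\<phi> / z)" for i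
    unfolding stat_p by (simp add: algebra_simps)
  have AG: "G \<le> (\<Sum>i\<in>UNIV. \<alpha> $ i * t i)"
    unfolding G_def using \<alpha> sum\<alpha> t by (intro weighted_geometric_le_arithmetic_mean) (auto simp: less_imp_le)
  have lnq: "ln (powm_phi \<alpha> u + w) = ln z + ln q"
    using q z w by (simp add: q_def ln_div)
  have lnw: "ln (- w) = ln g + ln s"
    using s g by (simp add: ws ln_mult)
  have sum1: "(\<Sum>i\<in>UNIV. p $ i * (u $ i - v $ i))
     = (\<Sum>i\<in>UNIV. (1 - \<alpha> $ i) * (t i - 1)) + \<phi> / z * ((\<Sum>i\<in>UNIV. \<alpha> $ i * t i) - 1)"
  proof -
    have "p $ i * (u $ i - v $ i) = (1 - \<alpha> $ i) * (t i - 1) + \<phi> / z * (\<alpha> $ i * t i - \<alpha> $ i)" for i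
    proof -
      have "p $ i * (u $ i - v $ i) = (p $ i * v $ i) * (t i - 1)"
        by (simp add: ut algebra_simps)
      also have "\<dots> = (1 - \<alpha> $ i + \<alpha> $ i * (\<phi> / z)) * (t i - 1)"
        unfolding pv ..
      finally show ?thesis by algebra
    qed
    then have "(\<Sum>i\<in>UNIV. p $ i * (u $ i - v $ i)) = (\<Sum>i\<in>UNIV. (1 - \<alpha> $ i) * (t i - 1))
        + \<phi> / z * (\<Sum>i\<in>UNIV. \<alpha> $ i * t i - \<alpha> $ i)"
      by (simp only: sum.distrib sum_distrib_left)
    then show ?thesis
      by (simp only: sum_subtractf sum\<alpha>)
  qed
  have qe: "\<phi> / z * (G - 1) - g / z * (s - 1) = q - 1"
  proof -
    have "\<phi> = z + g" by (simp add: z_def)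
    show ?thesis
      using z unfolding q_def phi_u ws \<open>\<phi> = z + g\<close> by (simp add: field_simps)
  qed
  \<comment> \<open>stationarity has cancelled every first-order term; each summand that remains is nonnegative\<close>
  have diff: "conj_grad_objective (powm_dual_barrier \<alpha>) (p, r) (v, - g)
      - conj_grad_objective (powm_dual_barrier \<alpha>) (p, r) y
      = \<phi> / z * ((\<Sum>i\<in>UNIV. \<alpha> $ i * t i) - G) + (\<Sum>i\<in>UNIV. (1 - \<alpha> $ i) * e (t i)) + e s + e q"
  proof -
    have "conj_grad_objective (powm_dual_barrier \<alpha>) (p, r) (v, - g)
      - conj_grad_objective (powm_dual_barrier \<alpha>) (p, r) y
      = (\<Sum>i\<in>UNIV. p $ i * (u $ i - v $ i)) + r * (w + g)
         - ln q - (\<Sum>i\<in>UNIV. (1 - \<alpha> $ i) * ln (t i)) - ln s"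
      unfolding yuw conj_grad_objective_def powm_dual_barrier_def
      by (simp add: inner_vec_def lnq lnw lnu distrib_left right_diff_distrib sum.distrib
          sum_subtractf flip: \<phi>_def z_def)
    also have "r * (w + g) = - (r * g) * (s - 1)" by (simp add: ws algebra_simps)
    also have "\<dots> = (s - 1) - g / z * (s - 1)" unfolding rg by (simp add: algebra_simps)
    also have "(\<Sum>i\<in>UNIV. p $ i * (u $ i - v $ i)) + ((s - 1) - g / z * (s - 1))
         - ln q - (\<Sum>i\<in>UNIV. (1 - \<alpha> $ i) * ln (t i)) - ln s
        = \<phi> / z * ((\<Sum>i\<in>UNIV. \<alpha> $ i * t i) - G) + (\<phi> / z * (G - 1) - g / z * (s - 1) - ln q)
          + ((\<Sum>i\<in>UNIV. (1 - \<alpha> $ i) * (t i - 1)) - (\<Sum>i\<in>UNIV. (1 - \<alpha> $ i) * ln (t i))) + (s - 1 - ln s)"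
      unfolding sum1 by (simp add: algebra_simps add_divide_distrib diff_divide_distrib)
    also have "\<dots> = \<phi> / z * ((\<Sum>i\<in>UNIV. \<alpha> $ i * t i) - G) + e q + (\<Sum>i\<in>UNIV. (1 - \<alpha> $ i) * e (t i)) + e s"
      unfolding qe by (simp add: e_def right_diff_distrib sum_subtractf)
    finally show ?thesis by simp
  qed
  have n1: "0 \<le> \<phi> / z * ((\<Sum>i\<in>UNIV. \<alpha> $ i * t i) - G)" using AG z \<open>\<phi> > 0\<close> by simp
  have n2: "0 \<le> (\<Sum>i\<in>UNIV. (1 - \<alpha> $ i) * e (t i))" using \<alpha>1 t e_nonneg by (intro sum_nonneg) simp
  have n3: "0 \<le> e s" "0 \<le> e q" using s q e_nonneg by auto
  show ?thesis
  proof (rule ccontr)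
    assume "\<not> ?thesis"
    then have "\<phi> / z * ((\<Sum>i\<in>UNIV. \<alpha> $ i * t i) - G) = 0" "e s = 0" "e q = 0"
      using diff n1 n2 n3 by linarith+
    then have GA: "G = (\<Sum>i\<in>UNIV. \<alpha> $ i * t i)" and s1: "s = 1" and q1: "q = 1"
      using z \<open>\<phi> > 0\<close> s q e_zero by auto
    \<comment> \<open>from here on \<open>G\<close> and the arithmetic mean are both 1, so the weighted sum of the gaps \<open>e (t i)\<close> is 0;
      this also covers a single coordinate of weight 1, where the sum over \<open>1 - \<alpha> $ i\<close> says nothing\<close>
    have G1: "G = 1" using qe z \<open>\<phi> > 0\<close> by (simp add: s1 q1)
    then have "(\<Sum>i\<in>UNIV. \<alpha> $ i * ln (t i)) = 0" by (simp add: G_def)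
    then have "(\<Sum>i\<in>UNIV. \<alpha> $ i * e (t i)) = 0"
      using GA G1 sum\<alpha> by (simp add: e_def right_diff_distrib sum_subtractf)
    then have "e (t i) = 0" for i
      using \<alpha> e_nonneg[OF t] by (subst (asm) sum_nonneg_eq_0_iff) (auto simp: less_imp_le less_imp_neq[symmetric])
    then have "t i = 1" for i using t e_zero by blast
    then have "y = (v, - g)" by (simp add: yuw ws s1 vec_eq_iff ut)
    with y(2) show False by simp
  qed
qed

lemma primal_conj_grad_powmI:
  fixes \<alpha> p v :: "real^'n" and r g :: real
  assumes \<alpha>: "\<forall>i. 0 < \<alpha> $ i" and sum\<alpha>: "(\<Sum>i\<in>UNIV. \<alpha> $ i) = 1"
    and p: "\<And>i. 0 < p $ i"
    and v: "\<And>i. v $ i = (1 + \<alpha> $ i * (1 + r * g)) / p $ i"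
    and v_pos: "\<And>i. 0 < v $ i" and g: "0 < g" "g < powm_phi \<alpha> v"
    and stat_r: "r = 1 / (powm_phi \<alpha> v - g) - 1 / g"
  shows "\<exists>!y. is_arg_max (conj_grad_objective (powm_dual_barrier \<alpha>) (p, r))
                 (\<lambda>y. y \<in> interior (powm_dual_cone \<alpha>)) y"
    and "primal_conj_grad (powm_dual_cone \<alpha>) (powm_dual_barrier \<alpha>) (p, r) = (- v, g)"
proof -
  let ?M = "is_arg_max (conj_grad_objective (powm_dual_barrier \<alpha>) (p, r))
                 (\<lambda>y. y \<in> interior (powm_dual_cone \<alpha>))"
  have pv: "p $ i * v $ i = 1 + \<alpha> $ i * (1 + r * g)" for i
    unfolding v using p[of i] by simp
  have mem: "(v, - g) \<in> interior (powm_dual_cone \<alpha>)"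
    using v_pos g unfolding interior_powm_dual_cone[OF \<alpha>] by simp
  have "?M y \<longleftrightarrow> y = (v, - g)" for y
    using stationary_point_strict_max[OF \<alpha> sum\<alpha> v_pos g pv stat_r] mem
    unfolding is_arg_max_def by (metis less_asym order_less_irrefl)
  then have "?M = (\<lambda>y. y = (v, - g))" by blast
  then show "\<exists>!y. ?M y"
    and "primal_conj_grad (powm_dual_cone \<alpha>) (powm_dual_barrier \<alpha>) (p, r) = (- v, g)"
    unfolding primal_conj_grad_def arg_max_on_def arg_max_def by auto
qed

section \<open>Newton's method for increasing concave functions\<close>

text \<open>
  If \<open>z - X n\<close> is the error, then by the mean value theorem the next error is this one times
  \<open>(h' (X n) - h' \<xi>) / h' (X n)\<close> with \<open>\<xi>\<close> between \<open>X n\<close> and \<open>z\<close>. As \<open>h'\<close> decreases, the factor lies in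
  \<open>[0, 1)\<close>, which keeps the iterates in the interval; as \<open>h''\<close> is bounded, the factor is at most a multiple
  of the error itself.
\<close>

lemma newton_concave_from_left:
  fixes h h' h'' :: "real \<Rightarrow> real" and a z :: real
  assumes "a \<le> z" and sub: "{a..z} \<subseteq> D" and zero: "h z = 0"
    and h: "\<And>x. x \<in> {a..z} \<Longrightarrow> (h has_real_derivative h' x) (at x)"
    and h': "\<And>x. x \<in> {a..z} \<Longrightarrow> (h' has_real_derivative h'' x) (at x)"
    and pos: "\<And>x. x \<in> {a..z} \<Longrightarrow> 0 < h' x"
    and concave: "\<And>x. x \<in> {a..z} \<Longrightarrow> h'' x \<le> 0"
    and cont: "continuous_on {a..z} h''"
  shows "newton_converges_quadratically h D a z"
proof -
  define X where "X = newton_seq h a"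
  have X_Suc: "X (Suc n) = X n - h (X n) / deriv h (X n)" for n
    by (simp add: X_def newton_seq_def)
  have deriv: "deriv h x = h' x" if "x \<in> {a..z}" for x
    using DERIV_imp_deriv[OF h[OF that]] .
  have h'_antimono: "h' y \<le> h' x" if "a \<le> x" "x \<le> y" "y \<le> z" for x y
    using that h' concave
    by (intro DERIV_nonpos_imp_nonincreasing[of x y h']) (meson atLeastAtMost_iff order.trans)+
  obtain B where B: "\<And>x. x \<in> {a..z} \<Longrightarrow> \<bar>h'' x\<bar> \<le> B"
  proof -
    have "bounded (h'' ` {a..z})"
      using compact_continuous_image[OF cont compact_Icc] by (rule compact_imp_bounded)
    then show ?thesis
      using that unfolding bounded_iff by (metis image_eqI real_norm_def)
  qed
  have h'_lipschitz: "h' x - h' y \<le> B * (y - x)" if "a \<le> x" "x \<le> y" "y \<le> z" for x y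
  proof (cases "x = y")
    case False
    then have "x < y" using that(2) by simp
    moreover have "(h' has_real_derivative h'' \<xi>) (at \<xi>)" if "x \<le> \<xi>" "\<xi> \<le> y" for \<xi>
      using h' that \<open>a \<le> x\<close> \<open>y \<le> z\<close> by simp
    ultimately obtain \<xi> where "x < \<xi>" "\<xi> < y" "h' y - h' x = (y - x) * h'' \<xi>"
      using MVT2[of x y h' h''] by blast
    moreover from this have "- h'' \<xi> \<le> B" using B[of \<xi>] that by force
    then have "(y - x) * (- h'' \<xi>) \<le> (y - x) * B"
      using that(2) by (intro mult_left_mono) auto
    ultimately show ?thesis by (simp add: mult.commute)
  qed simp
  have step: "X (Suc n) \<in> {a..z} \<and> z - X (Suc n) \<le> (1 - h' z / h' a) * (z - X n)
      \<and> z - X (Suc n) \<le> B / h' z * (z - X n)\<^sup>2" if n: "X n \<in> {a..z}" for n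
  proof -
    define x where "x = X n"
    have x: "a \<le> x" "x \<le> z" using n by (auto simp: x_def)
    \<comment> \<open>the secant slope between \<open>x\<close> and the root is a derivative value, hence comparable with \<open>h' x\<close>\<close>
    obtain \<xi> where \<xi>: "x \<le> \<xi>" "\<xi> \<le> z" "h x = - h' \<xi> * (z - x)"
    proof (cases "x = z")
      case True
      then show ?thesis using that[of z] zero by simp
    next
      case False
      then have "x < z" using x by simp
      moreover have "(h has_real_derivative h' \<xi>) (at \<xi>)" if "x \<le> \<xi>" "\<xi> \<le> z" for \<xi>
        using h that \<open>a \<le> x\<close> by simp
      ultimately obtain \<xi> where "x < \<xi>" "\<xi> < z" "h z - h x = (z - x) * h' \<xi>"
        using MVT2[of x z h h'] by blast
      then show ?thesis using that[of \<xi>] zero by (simp add: mult.commute)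
    qed
    have hp: "0 < h' x" "0 < h' z" "0 < h' a" using pos x \<open>a \<le> z\<close> by auto
    have err: "z - X (Suc n) = (h' x - h' \<xi>) / h' x * (z - x)"
      unfolding X_Suc deriv[OF n] using hp \<xi>(3) by (simp add: field_simps flip: x_def)
    have mono: "h' \<xi> \<le> h' x" "h' z \<le> h' \<xi>" "h' x \<le> h' a" "0 < h' \<xi>" "h' z \<le> h' x"
      using h'_antimono \<xi> x pos by auto
    have "0 \<le> z - X (Suc n)" unfolding err using mono hp x by simp
    moreover have "(h' x - h' \<xi>) / h' x \<le> 1" using hp mono by simp
    then have "z - X (Suc n) \<le> z - x"
      unfolding err using mult_right_mono[of "(h' x - h' \<xi>) / h' x" 1 "z - x"] x by simp
    moreover have "(h' x - h' \<xi>) / h' x \<le> 1 - h' z / h' a"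
    proof -
      have "h' z / h' a \<le> h' \<xi> / h' x" using mono hp by (intro frac_le) auto
      then show ?thesis using hp by (simp add: diff_divide_distrib)
    qed
    then have "z - X (Suc n) \<le> (1 - h' z / h' a) * (z - x)"
      unfolding err using x by (intro mult_right_mono) auto
    moreover have "(h' x - h' \<xi>) / h' x \<le> B * (z - x) / h' z"
    proof (rule frac_le)
      have B0: "0 \<le> B" using B[of z] \<open>a \<le> z\<close> by force
      then show "0 \<le> B * (z - x)" using x by simp
      from B0 have "B * (\<xi> - x) \<le> B * (z - x)" using \<xi> by (intro mult_left_mono) auto
      then show "h' x - h' \<xi> \<le> B * (z - x)" using h'_lipschitz[of x \<xi>] \<xi> x by simp
    qed (use \<open>0 < h' z\<close> mono in auto)
    then have "z - X (Suc n) \<le> B * (z - x) / h' z * (z - x)"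
      unfolding err using x by (intro mult_right_mono) auto
    ultimately show ?thesis using x by (auto simp: power2_eq_square mult.assoc simp flip: x_def)
  qed
  have in_range: "X n \<in> {a..z}" for n
  proof (induction n)
    case 0
    then show ?case using \<open>a \<le> z\<close> by (simp add: X_def newton_seq_def)
  qed (use step in blast)
  \<comment> \<open>a crude linear rate, which gives convergence; the quadratic bound alone would not\<close>
  define c where "c = 1 - h' z / h' a"
  have "0 < h' z" "h' z \<le> h' a" using pos h'_antimono \<open>a \<le> z\<close> by auto
  then have c: "0 \<le> c" "c < 1" by (auto simp: c_def)
  have geo: "z - X n \<le> c ^ n * (z - a)" for n
  proof (induction n)
    case 0
    then show ?case by (simp add: X_def newton_seq_def)
  next
    case (Suc n)
    have "z - X (Suc n) \<le> c * (z - X n)" using step[OF in_range] by (simp add: c_def)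
    also have "\<dots> \<le> c * (c ^ n * (z - a))" using Suc c by (intro mult_left_mono)
    finally show ?case by (simp add: mult.assoc)
  qed
  have "(\<lambda>n. c ^ n * (z - a)) \<longlonglongrightarrow> 0"
    using c LIMSEQ_realpow_zero[of c] by (auto intro: tendsto_mult_left_zero)
  then have "(\<lambda>n. z - X n) \<longlonglongrightarrow> 0"
  proof (rule tendsto_sandwich[OF _ _ tendsto_const, rotated -1])
    show "\<forall>\<^sub>F n in sequentially. 0 \<le> z - X n" using in_range by simp
    show "\<forall>\<^sub>F n in sequentially. z - X n \<le> c ^ n * (z - a)" using geo by simp
  qed
  then have "X \<longlonglongrightarrow> z"
    using tendsto_diff[OF tendsto_const[of z]] by force
  moreover have "\<forall>n. \<bar>X (Suc n) - z\<bar> \<le> B / h' z * \<bar>X n - z\<bar>\<^sup>2"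
  proof
    fix n show "\<bar>X (Suc n) - z\<bar> \<le> B / h' z * \<bar>X n - z\<bar>\<^sup>2"
      using step[OF in_range, of n] in_range[of "Suc n"]
      by (auto simp: power2_commute abs_minus_commute)
  qed
  moreover have "X n \<in> D \<and> h field_differentiable at (X n) \<and> deriv h (X n) \<noteq> 0" for n
    using in_range[of n] sub deriv[OF in_range, of n] pos[OF in_range, of n] h[OF in_range, of n]
    by (metis field_differentiable_def less_irrefl subsetD)
  ultimately show ?thesis
    unfolding newton_converges_quadratically_def X_def by blast
qed

lemma increasing_concave_newton:
  fixes h h' h'' :: "real \<Rightarrow> real" and D :: "real set"
  assumes up: "\<And>x y. x \<in> D \<Longrightarrow> x \<le> y \<Longrightarrow> y \<in> D"
    and h: "\<And>x. x \<in> D \<Longrightarrow> (h has_real_derivative h' x) (at x)"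
    and h': "\<And>x. x \<in> D \<Longrightarrow> (h' has_real_derivative h'' x) (at x)"
    and pos: "\<And>x. x \<in> D \<Longrightarrow> 0 < h' x"
    and concave: "\<And>x. x \<in> D \<Longrightarrow> h'' x \<le> 0"
    and cont: "continuous_on D h''"
    and a: "a \<in> D" "h a \<le> 0" and b: "b \<in> D" "0 \<le> h b"
  shows "\<exists>z\<in>D. a \<le> z \<and> h z = 0 \<and> (\<forall>x\<in>D. h x = 0 \<longrightarrow> x = z)
    \<and> newton_converges_quadratically h D a z"
proof -
  have strict: "h x < h y" if "x \<in> D" "x < y" for x y
    using that h pos up by (intro DERIV_pos_imp_increasing[of x y h]) blast+
  have "a \<le> b" using strict[of b a] a b by force
  have "\<exists>z\<ge>a. z \<le> b \<and> h z = 0"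
  proof (rule IVT)
    show "\<forall>x. a \<le> x \<and> x \<le> b \<longrightarrow> isCont h x" using h up[OF a(1)] DERIV_isCont by blast
  qed (use a b \<open>a \<le> b\<close> in auto)
  then obtain z where z: "a \<le> z" "h z = 0" by blast
  have "z \<in> D" using up a z by blast
  moreover have "x = z" if "x \<in> D" "h x = 0" for x
    using strict[of x z] strict[of z x] that z \<open>z \<in> D\<close> by force
  moreover have sub: "{a..z} \<subseteq> D" using up[OF a(1)] by auto
  have "newton_converges_quadratically h D a z"
    using sub by (intro newton_concave_from_left[of a z D h h' h''] z h h' pos concave
        continuous_on_subset[OF cont]) auto
  ultimately show ?thesis using z by blast
qed

section \<open>The root equation for positive r\<close>

text \<open>
  With \<open>a i = \<alpha> i / (1 + \<alpha> i)\<close> the derivative is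
  \<open>(\<Sum>i. \<alpha> i / (x + r * a i)) - 1 / (x + r/2) + 1 / (x + r)\<close>. Since \<open>a i \<le> 1/2\<close>, the sum is at least
  \<open>1 / (x + r/2)\<close>, so \<open>h' x \<ge> 1 / (x + r)\<close>; the same comparison with squares gives \<open>h'' x \<le> - 1 / (x + r)^2\<close>.
  The hypothesis that \<open>r\<close> is below the geometric mean of \<open>p\<close> says precisely that \<open>h 0 < 0\<close>.
\<close>

lemma powm_h_pos_newton:
  fixes \<alpha> p :: "real^'n" and r :: real
  assumes \<alpha>: "\<forall>i. 0 < \<alpha> $ i" and sum\<alpha>: "(\<Sum>i\<in>UNIV. \<alpha> $ i) = 1"
    and p: "\<And>i. 0 < p $ i" and r: "0 < r" "r < (\<Prod>i\<in>UNIV. (p $ i) powr (\<alpha> $ i))"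
  obtains z where "z \<in> powm_h_pos_dom \<alpha> p r" "0 < z" "powm_h_pos \<alpha> p r z = 0"
    "\<And>x. x \<in> powm_h_pos_dom \<alpha> p r \<Longrightarrow> powm_h_pos \<alpha> p r x = 0 \<Longrightarrow> x = z"
    "newton_converges_quadratically (powm_h_pos \<alpha> p r) (powm_h_pos_dom \<alpha> p r) 0 z"
proof -
  define a where "a = (\<lambda>i. \<alpha> $ i / (1 + \<alpha> $ i))"
  define c where "c = (\<lambda>i. (1 + \<alpha> $ i) / (\<alpha> $ i * p $ i))"
  define D where "D = powm_h_pos_dom \<alpha> p r"
  define h where "h = powm_h_pos \<alpha> p r"
  define h' where "h' = (\<lambda>x. (\<Sum>i\<in>UNIV. \<alpha> $ i / (x + r * a i)) - (1 / (x + r / 2) - 1 / (x + r)))"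
  define h'' where "h'' = (\<lambda>x. - (\<Sum>i\<in>UNIV. \<alpha> $ i / (x + r * a i)\<^sup>2) + 1 / (x + r / 2)\<^sup>2 - 1 / (x + r)\<^sup>2)"
  have c: "0 < c i" for i using \<alpha>[rule_format, of i] p[of i] by (simp add: c_def)
  have a: "0 < a i" "a i \<le> 1 / 2" for i
    using \<alpha>[rule_format, of i] weight_le_one[OF \<alpha> sum\<alpha>, of i] by (auto simp: a_def field_simps)
  \<comment> \<open>each logarithm has the argument \<open>c i * (x + r * a i)\<close>; so \<open>a i\<close> locates its singularity \<open>- r * a i\<close>\<close>
  have arg: "c i * x + r / p $ i = c i * (x + r * a i)" for i x
  proof -
    have "c i * a i = 1 / p $ i"
      using \<alpha>[rule_format, of i] p[of i] by (simp add: a_def c_def)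
    then show ?thesis by (simp add: distrib_left mult.left_commute)
  qed
  have ra: "r * a i \<le> r / 2" for i
    using mult_left_mono[OF a(2), of r i] r(1) by simp
  have half: "0 < x + r / 2" if "\<And>i. 0 < x + r * a i" for x
    using that[of undefined] ra[of undefined] by linarith
  have D_iff: "x \<in> D \<longleftrightarrow> (\<forall>i. 0 < x + r * a i)" for x
  proof -
    have "0 < 1 + x / (r + x)" "r + x \<noteq> 0" if "\<forall>i. 0 < x + r * a i"
      using half[of x] that r(1) by (auto simp: field_simps)
    moreover have "0 < (1 + \<alpha> $ i) / (\<alpha> $ i * p $ i) * x + r / p $ i \<longleftrightarrow> 0 < x + r * a i" for i
      using arg[of i x] mult_less_cancel_left_pos[OF c[of i], of 0 "x + r * a i"] by (simp add: c_def)
    ultimately show ?thesis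
      unfolding D_def powm_h_pos_dom_def by blast
  qed
  have D_pos: "0 < x + r * a i" "0 < x + r / 2" "0 < x + r" if "x \<in> D" for x i
    using that half[of x] r(1) unfolding D_iff by auto
  have h_eq: "h x = (\<Sum>i\<in>UNIV. \<alpha> $ i * ln (c i * (x + r * a i))) - ln (1 + x / (r + x))" for x
    unfolding h_def powm_h_pos_def by (simp only: arg[unfolded c_def] c_def)
  \<comment> \<open>\<open>a i \<le> 1/2\<close> lets the weighted sums absorb the term \<open>1 / (x + r/2)\<close> of the last logarithm\<close>
  have mean_ge: "1 / (x + r / 2) \<le> (\<Sum>i\<in>UNIV. \<alpha> $ i / (x + r * a i))"
    and mean_sq_ge: "1 / (x + r / 2)\<^sup>2 \<le> (\<Sum>i\<in>UNIV. \<alpha> $ i / (x + r * a i)\<^sup>2)" if "x \<in> D" for x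
  proof -
    have le: "x + r * a i \<le> x + r / 2" for i
      using ra by simp
    have "(\<Sum>i\<in>UNIV. \<alpha> $ i / (x + r / 2)) \<le> (\<Sum>i\<in>UNIV. \<alpha> $ i / (x + r * a i))"
      using le D_pos[OF that] \<alpha> by (intro sum_mono divide_left_mono) (auto simp: less_imp_le)
    then show "1 / (x + r / 2) \<le> (\<Sum>i\<in>UNIV. \<alpha> $ i / (x + r * a i))"
      by (simp only: sum\<alpha> flip: sum_divide_distrib)
    have "(\<Sum>i\<in>UNIV. \<alpha> $ i / (x + r / 2)\<^sup>2) \<le> (\<Sum>i\<in>UNIV. \<alpha> $ i / (x + r * a i)\<^sup>2)"
      using le D_pos[OF that] \<alpha>
      by (intro sum_mono divide_left_mono power_mono mult_pos_pos zero_less_power) (auto simp: less_imp_le)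
    then show "1 / (x + r / 2)\<^sup>2 \<le> (\<Sum>i\<in>UNIV. \<alpha> $ i / (x + r * a i)\<^sup>2)"
      by (simp only: sum\<alpha> flip: sum_divide_distrib)
  qed
  have up: "y \<in> D" if "x \<in> D" "x \<le> y" for x y
    using that unfolding D_iff by (meson add_right_mono less_le_trans)
  have dh: "(h has_real_derivative h' x) (at x)" if "x \<in> D" for x
  proof -
    note pos = D_pos[OF that]
    have "((\<lambda>x. \<alpha> $ i * ln (c i * (x + r * a i))) has_real_derivative \<alpha> $ i / (x + r * a i)) (at x)" for i
      using pos(1)[of i] c[of i] by (auto intro!: derivative_eq_intros)
    moreover have "((\<lambda>x. ln (1 + x / (r + x))) has_real_derivative 1 / (x + r / 2) - 1 / (x + r)) (at x)"
    proof -
      have eq: "1 + x / (r + x) = 2 * (x + r / 2) / (x + r)" using pos(3) by (simp add: field_simps)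
      have "((\<lambda>x. 1 + x / (r + x)) has_real_derivative r / (x + r)\<^sup>2) (at x)"
        using pos(3) by (auto intro!: derivative_eq_intros simp: power2_eq_square add.commute)
      moreover have "0 < 1 + x / (r + x)" unfolding eq using pos by simp
      ultimately have "((\<lambda>x. ln (1 + x / (r + x))) has_real_derivative
          1 / (1 + x / (r + x)) * (r / (x + r)\<^sup>2)) (at x)"
        by (intro DERIV_chain2[OF DERIV_ln_divide])
      moreover have "1 / (1 + x / (r + x)) * (r / (x + r)\<^sup>2) = 1 / (x + r / 2) - 1 / (x + r)"
      proof -
        define u where "u = x + r / 2"
        have xr: "x + r = u + r / 2" by (simp add: u_def)
        have "0 < u" "0 < u + r / 2" using pos by (auto simp: u_def)
        then show ?thesis unfolding eq unfolding xr u_def[symmetric]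
          by (simp add: divide_simps power2_eq_square)
      qed
      ultimately show ?thesis by simp
    qed
    ultimately show ?thesis
      unfolding h_eq[abs_def] h'_def by (intro DERIV_diff DERIV_sum)
  qed
  have dh': "(h' has_real_derivative h'' x) (at x)" if "x \<in> D" for x
  proof -
    note pos = D_pos[OF that]
    have inv: "((\<lambda>x. k / (x + b)) has_real_derivative - (k / (x + b)\<^sup>2)) (at x)" if "0 < x + b" for b k
      using that by (auto intro!: derivative_eq_intros simp: power2_eq_square)
    have "(h' has_real_derivative (\<Sum>i\<in>UNIV. - (\<alpha> $ i / (x + r * a i)\<^sup>2))
        - (- (1 / (x + r / 2)\<^sup>2) - - (1 / (x + r)\<^sup>2))) (at x)"
      unfolding h'_def by (intro DERIV_diff DERIV_sum inv pos)
    then show ?thesis by (rule DERIV_cong) (simp add: h''_def sum_negf)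
  qed
  have pos: "0 < h' x" and conc: "h'' x \<le> 0" if "x \<in> D" for x
  proof -
    have "0 < 1 / (x + r)" "0 < 1 / (x + r)\<^sup>2" using D_pos[OF that] by simp_all
    then show "0 < h' x" "h'' x \<le> 0"
      using mean_ge[OF that] mean_sq_ge[OF that] unfolding h'_def h''_def by linarith+
  qed
  have cont: "continuous_on D h''"
    unfolding h''_def by (intro continuous_intros ballI power_not_zero less_imp_neq[symmetric] D_pos)
  have D_nonneg: "x \<in> D" if "0 \<le> x" for x
    unfolding D_iff using that a r(1) by (auto intro!: add_nonneg_pos)
  have h0: "h 0 < 0"
  proof -
    have "c i * (0 + r * a i) = r * (1 / p $ i)" for i
      using arg[of i 0] by simp
    then have "h 0 = (\<Sum>i\<in>UNIV. \<alpha> $ i * ln (r * (1 / p $ i)))" by (simp add: h_eq)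
    also have "\<dots> = ln r + (\<Sum>i\<in>UNIV. \<alpha> $ i * ln (1 / p $ i))"
      using weighted_sum_ln_scale[OF sum\<alpha> r(1), of "\<lambda>i. 1 / p $ i"] p by simp
    also have "\<dots> = ln r - (\<Sum>i\<in>UNIV. \<alpha> $ i * ln (p $ i))"
      by (simp add: ln_inverse sum_negf flip: inverse_eq_divide)
    also have "\<dots> < 0"
    proof -
      have "r < exp (\<Sum>i\<in>UNIV. \<alpha> $ i * ln (p $ i))"
        using r(2) p by (simp add: prod_powr_eq_exp)
      then show ?thesis using r(1) by (metis diff_less_0_iff_less exp_less_cancel_iff exp_ln)
    qed
    finally show ?thesis .
  qed
  \<comment> \<open>at \<open>b\<close> the terms \<open>ln (c i * b)\<close> alone average to \<open>ln 2\<close>, which bounds the last logarithm\<close>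
  define b where "b = exp (ln 2 - (\<Sum>i\<in>UNIV. \<alpha> $ i * ln (c i)))"
  have b: "0 < b" by (simp add: b_def)
  have hb: "0 \<le> h b"
  proof -
    have "ln 2 = (\<Sum>i\<in>UNIV. \<alpha> $ i * ln (b * c i))"
      using weighted_sum_ln_scale[OF sum\<alpha> b, of c] c by (simp add: b_def)
    also have "\<dots> \<le> (\<Sum>i\<in>UNIV. \<alpha> $ i * ln (c i * (b + r * a i)))"
    proof (intro sum_mono mult_left_mono ln_mono)
      show "b * c i \<le> c i * (b + r * a i)" for i using c[of i] a(1)[of i] r(1) by (simp add: algebra_simps)
    qed (use b c \<alpha> a(1) r(1) in \<open>auto simp: less_imp_le\<close>)
    finally have "ln 2 \<le> (\<Sum>i\<in>UNIV. \<alpha> $ i * ln (c i * (b + r * a i)))" .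
    moreover have "ln (1 + b / (r + b)) \<le> ln 2"
      using b r(1) by (intro ln_mono) (auto simp: add_pos_pos)
    ultimately show ?thesis by (simp add: h_eq)
  qed
  have "\<exists>z\<in>D. 0 \<le> z \<and> h z = 0 \<and> (\<forall>x\<in>D. h x = 0 \<longrightarrow> x = z)
      \<and> newton_converges_quadratically h D 0 z"
    by (rule increasing_concave_newton[OF up dh dh' pos conc cont D_nonneg[OF order_refl]
        less_imp_le[OF h0] D_nonneg[OF less_imp_le[OF b]] hb])
  then obtain z where z: "z \<in> D" "0 \<le> z" "h z = 0" "\<And>x. x \<in> D \<Longrightarrow> h x = 0 \<Longrightarrow> x = z"
      "newton_converges_quadratically h D 0 z" by blast
  have "0 < z" using h0 z(2,3) by (cases "z = 0") auto
  with z show ?thesis unfolding D_def h_def by (intro that)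
qed

section \<open>The root equation for negative r\<close>

text \<open>
  The function \<open>S x = sqrt (r^2 + 4 * x^2)\<close> lies between \<open>- r\<close> and \<open>2 * \<bar>x\<bar> - r\<close>. Together with \<open>\<alpha> i \<le> 1\<close>
  this identifies the domain as the positive half-line, and it yields points on both sides of the root.
\<close>

lemma powm_h_neg_newton:
  fixes \<alpha> p :: "real^'n" and r :: real
  assumes \<alpha>: "\<forall>i. 0 < \<alpha> $ i" and sum\<alpha>: "(\<Sum>i\<in>UNIV. \<alpha> $ i) = 1"
    and p: "\<And>i. 0 < p $ i" and r: "r < 0"
  obtains z where "z \<in> powm_h_neg_dom \<alpha> p r" "0 < z" "powm_h_neg \<alpha> p r z = 0"
    "\<And>x. x \<in> powm_h_neg_dom \<alpha> p r \<Longrightarrow> powm_h_neg \<alpha> p r x = 0 \<Longrightarrow> x = z"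
    "newton_converges_quadratically (powm_h_neg \<alpha> p r) (powm_h_neg_dom \<alpha> p r)
       (\<Prod>i\<in>UNIV. (\<alpha> $ i * p $ i / (1 + \<alpha> $ i)) powr (\<alpha> $ i)) z"
proof -
  define S where "S = (\<lambda>x. sqrt (r\<^sup>2 + 4 * x\<^sup>2))"
  define A where "A = (\<lambda>i x. x / \<alpha> $ i + (r + S x) / 2)"
  define h where "h = powm_h_neg \<alpha> p r"
  define h' where "h' = (\<lambda>x. \<Sum>i\<in>UNIV. \<alpha> $ i * ((1 / \<alpha> $ i + 2 * x / S x) / A i x))"
  define h'' where "h'' = (\<lambda>x. \<Sum>i\<in>UNIV. \<alpha> $ i *
     ((2 * r\<^sup>2 / (S x) ^ 3 * A i x - (1 / \<alpha> $ i + 2 * x / S x)\<^sup>2) / (A i x)\<^sup>2))"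
  define a where "a = (\<Prod>i\<in>UNIV. (\<alpha> $ i * p $ i / (1 + \<alpha> $ i)) powr (\<alpha> $ i))"
  have ap: "0 < \<alpha> $ i" for i using \<alpha> by blast
  have S_sq: "(S x)\<^sup>2 = r\<^sup>2 + 4 * x\<^sup>2" for x by (simp add: S_def)
  have S_ge: "- r \<le> S x" for x
    unfolding S_def by (rule real_le_rsqrt) simp
  have S_pos: "0 < S x" for x using S_ge[of x] r by linarith
  have S_le: "S x \<le> 2 * \<bar>x\<bar> - r" for x
  proof -
    have "(S x)\<^sup>2 \<le> (2 * \<bar>x\<bar> - r)\<^sup>2"
      using r mult_nonneg_nonpos[of "\<bar>x\<bar>" r] unfolding S_sq by (simp add: power2_eq_square algebra_simps)
    moreover have "0 \<le> 2 * \<bar>x\<bar> - r" using r by linarith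
    ultimately show ?thesis by (rule power2_le_imp_le)
  qed
  have A_pos: "0 < A i x" if "0 < x" for i x
    using S_ge[of x] that ap[of i] by (auto simp: A_def intro!: add_pos_nonneg)
  have A_nonpos: "A i x \<le> 0" if "x \<le> 0" for i x
  proof -
    have "- x * 1 \<le> - x * (1 / \<alpha> $ i)"
      using weight_le_one[OF \<alpha> sum\<alpha>, of i] ap[of i] that by (intro mult_left_mono) auto
    then have "x / \<alpha> $ i \<le> x" by simp
    moreover have "(r + S x) / 2 \<le> - x" using S_le[of x] that by simp
    ultimately show ?thesis unfolding A_def by linarith
  qed
  have arg: "x / (\<alpha> $ i * p $ i) + (r + sqrt (r\<^sup>2 + 4 * x\<^sup>2)) / (2 * p $ i) = A i x / p $ i" for i x
    by (simp add: A_def S_def add_divide_distrib)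
  have D_eq: "powm_h_neg_dom \<alpha> p r = {0<..}"
  proof -
    have "0 < A i x / p $ i \<longleftrightarrow> 0 < x" for i x
      using A_pos[of x i] A_nonpos[of x i] p[of i] by (auto simp: zero_less_divide_iff not_less[symmetric])
    then show ?thesis unfolding powm_h_neg_dom_def arg by auto
  qed
  have h_eq: "h x = (\<Sum>i\<in>UNIV. \<alpha> $ i * ln (A i x / p $ i))" for x
    by (simp only: h_def powm_h_neg_def arg)
  have dS: "(S has_real_derivative 4 * x / S x) (at x)" for x
  proof -
    have "0 < r\<^sup>2 + 4 * x\<^sup>2" using r by (intro add_pos_nonneg) auto
    then show ?thesis unfolding S_def by (auto intro!: derivative_eq_intros simp: field_simps)
  qed
  have dA: "(A i has_real_derivative 1 / \<alpha> $ i + 2 * x / S x) (at x)" for i x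
    unfolding A_def
    by (rule DERIV_cong[OF DERIV_add[OF DERIV_cdivide[OF DERIV_ident]
          DERIV_cdivide[OF DERIV_add[OF DERIV_const dS]]]]) simp
  have dA': "((\<lambda>x. 1 / \<alpha> $ i + 2 * x / S x) has_real_derivative 2 * r\<^sup>2 / (S x) ^ 3) (at x)" for i x
  proof -
    have "((\<lambda>x. 1 / \<alpha> $ i + 2 * x / S x) has_real_derivative
        (2 * S x - 2 * x * (4 * x / S x)) / (S x)\<^sup>2) (at x)"
      using S_pos[of x] by (auto intro!: derivative_eq_intros dS simp: power2_eq_square)
    moreover have "(2 * S x - 2 * x * (4 * x / S x)) / (S x)\<^sup>2 = 2 * ((S x)\<^sup>2 - 4 * x\<^sup>2) / (S x) ^ 3"
      using S_pos[of x] by (simp add: field_simps power2_eq_square power3_eq_cube)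
    ultimately show ?thesis unfolding S_sq by simp
  qed
  have dh: "(h has_real_derivative h' x) (at x)" if "0 < x" for x
  proof -
    have "((\<lambda>x. \<alpha> $ i * ln (A i x / p $ i)) has_real_derivative
        \<alpha> $ i * ((1 / \<alpha> $ i + 2 * x / S x) / A i x)) (at x)" for i
    proof -
      have "((\<lambda>x. ln (A i x / p $ i)) has_real_derivative
          1 / (A i x / p $ i) * ((1 / \<alpha> $ i + 2 * x / S x) / p $ i)) (at x)"
        using A_pos[OF that] p by (intro DERIV_chain2[OF DERIV_ln_divide] DERIV_cdivide dA) simp
      also have "1 / (A i x / p $ i) * ((1 / \<alpha> $ i + 2 * x / S x) / p $ i) = (1 / \<alpha> $ i + 2 * x / S x) / A i x"
        using p[of i] by simp
      finally show ?thesis by (rule DERIV_cmult)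
    qed
    then show ?thesis unfolding h_eq[abs_def] h'_def by (intro DERIV_sum)
  qed
  have dh': "(h' has_real_derivative h'' x) (at x)" if "0 < x" for x
  proof -
    have "((\<lambda>x. (1 / \<alpha> $ i + 2 * x / S x) / A i x) has_real_derivative
       (2 * r\<^sup>2 / (S x) ^ 3 * A i x - (1 / \<alpha> $ i + 2 * x / S x)\<^sup>2) / (A i x)\<^sup>2) (at x)" for i
      using DERIV_divide[OF dA'[of i x] dA[of i x]] A_pos[OF that, of i]
      by (simp add: power2_eq_square)
    then show ?thesis unfolding h'_def h''_def by (intro DERIV_sum DERIV_cmult)
  qed
  have pos: "0 < h' x" if "0 < x" for x
    unfolding h'_def using A_pos[OF that] S_pos[of x] ap that
    by (intro sum_pos mult_pos_pos divide_pos_pos add_pos_pos) auto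
  \<comment> \<open>The logarithm is concave but its argument \<open>A i\<close> is convex, so the two effects must be compared:
    \<open>A'' * A \<le> A'^2\<close>, shown separately for the linear part and for \<open>k = (r + S x) / 2\<close> of \<open>A\<close>.\<close>
  have conc: "h'' x \<le> 0" if "0 < x" for x
  proof -
    have "2 * r\<^sup>2 / (S x) ^ 3 * A i x \<le> (1 / \<alpha> $ i + 2 * x / S x)\<^sup>2" for i
    proof -
      define k where "k = (r + S x) / 2"
      have k: "0 \<le> k" using S_ge[of x] by (simp add: k_def)
      have r2: "r\<^sup>2 \<le> (S x)\<^sup>2" by (simp add: S_sq)
      have x1: "2 * r\<^sup>2 / (S x) ^ 3 * x \<le> 2 * x / S x"
        using r2 S_pos[of x] that by (simp add: divide_simps power2_eq_square power3_eq_cube)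
      have "2 * r\<^sup>2 * k \<le> 4 * x\<^sup>2 * S x"
      proof -
        have "2 * r\<^sup>2 * k = r\<^sup>2 * (r + S x)" by (simp add: k_def)
        also have "\<dots> \<le> ((S x - r) * S x) * (r + S x)"
        proof (rule mult_right_mono)
          have "- r * - r \<le> S x * S x" using S_ge[of x] r by (intro mult_mono) auto
          then show "r\<^sup>2 \<le> (S x - r) * S x"
            using r S_pos[of x] mult_neg_pos[of r "S x"] by (simp add: power2_eq_square algebra_simps)
        qed (use S_ge[of x] in simp)
        also have "\<dots> = ((S x)\<^sup>2 - r\<^sup>2) * S x" by (simp add: power2_eq_square algebra_simps)
        finally show ?thesis by (simp add: S_sq)
      qed
      then have x2: "2 * r\<^sup>2 / (S x) ^ 3 * k \<le> (2 * x / S x)\<^sup>2"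
        using S_pos[of x] by (simp add: divide_simps power2_eq_square power3_eq_cube mult_ac)
      have "2 * r\<^sup>2 / (S x) ^ 3 * A i x = (2 * r\<^sup>2 / (S x) ^ 3 * x) / \<alpha> $ i + 2 * r\<^sup>2 / (S x) ^ 3 * k"
        by (simp add: A_def k_def distrib_left)
      also have "\<dots> \<le> (2 * x / S x) / \<alpha> $ i + (2 * x / S x)\<^sup>2"
        using x1 x2 ap[of i] by (intro add_mono divide_right_mono) auto
      also have "\<dots> \<le> (1 / \<alpha> $ i + 2 * x / S x)\<^sup>2"
      proof -
        define c d where "c = 1 / \<alpha> $ i" and "d = 2 * x / S x"
        have "0 \<le> c" "0 \<le> d" using ap[of i] that S_pos[of x] by (auto simp: c_def d_def)
        then have "d * c + d\<^sup>2 \<le> (c + d)\<^sup>2" by (simp add: power2_sum mult.commute)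
        then show ?thesis by (simp add: c_def d_def)
      qed
      finally show ?thesis .
    qed
    then show ?thesis unfolding h''_def using ap
      by (intro sum_nonpos mult_nonneg_nonpos divide_nonpos_nonneg) (auto simp: less_imp_le)
  qed
  have "continuous_on {0<..} S"
    using dS by (intro continuous_at_imp_continuous_on ballI DERIV_isCont)
  moreover have "continuous_on {0<..} (A i)" for i
    using dA by (intro continuous_at_imp_continuous_on ballI DERIV_isCont)
  ultimately have cont: "continuous_on {0<..} h''"
    unfolding h''_def using A_pos S_pos
    by (intro continuous_intros ballI power_not_zero less_imp_neq[symmetric]) auto
  have a_exp: "a = exp (- (\<Sum>i\<in>UNIV. \<alpha> $ i * ln (1 / \<alpha> $ i / p $ i + 1 / p $ i)))"
  proof -
    have "0 < \<alpha> $ i * p $ i / (1 + \<alpha> $ i)" for i using ap[of i] p[of i] by simp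
    then have "a = exp (\<Sum>i\<in>UNIV. \<alpha> $ i * ln (\<alpha> $ i * p $ i / (1 + \<alpha> $ i)))"
      unfolding a_def by (simp add: prod_powr_eq_exp)
    moreover have "ln (\<alpha> $ i * p $ i / (1 + \<alpha> $ i)) = - ln (1 / \<alpha> $ i / p $ i + 1 / p $ i)" for i
    proof -
      have "1 / \<alpha> $ i / p $ i + 1 / p $ i = inverse (\<alpha> $ i * p $ i / (1 + \<alpha> $ i))"
        using ap[of i] p[of i] by (simp add: field_simps)
      then show ?thesis by (simp only: ln_inverse minus_minus)
    qed
    ultimately show ?thesis by (simp only: mult_minus_right sum_negf)
  qed
  have "0 < a" by (simp add: a_exp)
  \<comment> \<open>replacing \<open>(r + S a) / 2\<close> by its upper bound \<open>a\<close> makes every argument linear in \<open>a\<close>,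
    and \<open>a\<close> is the root of the resulting function\<close>
  have ha: "h a \<le> 0"
  proof -
    have "h a \<le> (\<Sum>i\<in>UNIV. \<alpha> $ i * ln (a * (1 / \<alpha> $ i / p $ i + 1 / p $ i)))"
      unfolding h_eq
    proof (intro sum_mono mult_left_mono ln_mono)
      fix i
      have "A i a \<le> a / \<alpha> $ i + a" using S_le[of a] \<open>0 < a\<close> by (simp add: A_def)
      then have "A i a / p $ i \<le> (a / \<alpha> $ i + a) / p $ i" using p[of i] by (intro divide_right_mono) auto
      then show "A i a / p $ i \<le> a * (1 / \<alpha> $ i / p $ i + 1 / p $ i)"
        by (simp add: distrib_left add_divide_distrib)
      show "0 < A i a / p $ i" using A_pos[OF \<open>0 < a\<close>] p by simp
      show "0 \<le> \<alpha> $ i" using ap[of i] by simp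
    qed
    also have "\<dots> = ln a + (\<Sum>i\<in>UNIV. \<alpha> $ i * ln (1 / \<alpha> $ i / p $ i + 1 / p $ i))"
      using ap p by (intro weighted_sum_ln_scale[OF sum\<alpha> \<open>0 < a\<close>] add_pos_pos divide_pos_pos) auto
    finally show ?thesis by (simp add: a_exp)
  qed
  \<comment> \<open>\<open>b\<close> is the root of the function obtained by dropping the nonnegative \<open>(r + S x) / 2\<close>\<close>
  define b where "b = exp (- (\<Sum>i\<in>UNIV. \<alpha> $ i * ln (1 / \<alpha> $ i / p $ i)))"
  have "0 < b" by (simp add: b_def)
  have hb: "0 \<le> h b"
  proof -
    have "0 = ln b + (\<Sum>i\<in>UNIV. \<alpha> $ i * ln (1 / \<alpha> $ i / p $ i))" by (simp add: b_def)
    also have "\<dots> = (\<Sum>i\<in>UNIV. \<alpha> $ i * ln (b * (1 / \<alpha> $ i / p $ i)))"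
      using ap p by (intro weighted_sum_ln_scale[OF sum\<alpha> \<open>0 < b\<close>, symmetric] divide_pos_pos) auto
    also have "\<dots> \<le> h b"
      unfolding h_eq
    proof (intro sum_mono mult_left_mono ln_mono)
      fix i
      have "b / \<alpha> $ i \<le> A i b" using S_ge[of b] by (simp add: A_def)
      then have "b / \<alpha> $ i / p $ i \<le> A i b / p $ i" using p[of i] by (intro divide_right_mono) auto
      then show "b * (1 / \<alpha> $ i / p $ i) \<le> A i b / p $ i" by simp
      show "0 < b * (1 / \<alpha> $ i / p $ i)" using ap[of i] p[of i] \<open>0 < b\<close> by simp
      show "0 \<le> \<alpha> $ i" using ap[of i] by simp
    qed
    finally show ?thesis .
  qed
  have "\<exists>z\<in>{0<..}. a \<le> z \<and> h z = 0 \<and> (\<forall>x\<in>{0<..}. h x = 0 \<longrightarrow> x = z)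
      \<and> newton_converges_quadratically h {0<..} a z"
    using dh dh' pos conc cont \<open>0 < a\<close> ha \<open>0 < b\<close> hb
    by (intro increasing_concave_newton[of "{0<..}" h h' h'' a b]) simp_all
  then obtain z where z: "z \<in> {0<..}" "h z = 0" "\<And>x. x \<in> {0<..} \<Longrightarrow> h x = 0 \<Longrightarrow> x = z"
      "newton_converges_quadratically h {0<..} a z" by blast
  from z(1) have "0 < z" by simp
  with z show ?thesis
    unfolding h_def a_def by (intro that[unfolded D_eq])
qed

section \<open>From roots to conjugate gradients\<close>

lemma powm_phi_at_powm_h_pos_root:
  fixes \<alpha> p v :: "real^'n" and r x :: real
  assumes \<alpha>: "\<forall>i. 0 < \<alpha> $ i" and sum\<alpha>: "(\<Sum>i\<in>UNIV. \<alpha> $ i) = 1"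
    and p: "\<And>i. 0 < p $ i" and r: "0 < r" and x: "0 < x" and root: "powm_h_pos \<alpha> p r x = 0"
    and v: "\<And>i. v $ i = (1 + \<alpha> $ i * (1 + r * (1 / x))) / p $ i"
  shows "0 < v $ i" and "powm_phi \<alpha> v = 1 / x + 1 / (r + x)"
proof -
  have ap: "0 < \<alpha> $ i" for i using \<alpha> by blast
  have v_pos: "0 < v $ i" for i
    unfolding v using ap[of i] p[of i] r x by (intro divide_pos_pos add_pos_pos mult_pos_pos) auto
  then show "0 < v $ i" .
  have scale: "x * (v $ i / \<alpha> $ i) = (1 + \<alpha> $ i) / (\<alpha> $ i * p $ i) * x + r / p $ i" for i
    unfolding v using ap[of i] p[of i] x by (simp add: field_simps)
  have "x * powm_phi \<alpha> v = exp (ln (1 + x / (r + x)))"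
    using powm_phi_scale[OF \<alpha> sum\<alpha> v_pos x] root unfolding scale powm_h_pos_def by simp
  also have "\<dots> = 1 + x / (r + x)"
    using x r by (intro exp_ln add_pos_pos) auto
  finally have "powm_phi \<alpha> v = (1 + x / (r + x)) / x"
    using x by (metis less_irrefl nonzero_mult_div_cancel_left)
  then show "powm_phi \<alpha> v = 1 / x + 1 / (r + x)"
    using x by (simp add: add_divide_distrib)
qed

text \<open>
  With \<open>\<phi> = 1 / x\<close>, the equation \<open>r = 1 / (\<phi> - g) - 1 / g\<close> is quadratic in \<open>g\<close>. For negative \<open>r\<close> its smaller
  root is the one with \<open>0 < g < \<phi>\<close>, and \<open>1 + r * g\<close> simplifies to the square-root term in the definition of \<open>h\<close>.
\<close>

lemma negative_stationarity_branch:
  fixes r x g S :: real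
  assumes r: "r < 0" and x: "0 < x"
  defines "S \<equiv> sqrt (r\<^sup>2 + 4 * x\<^sup>2)"
    and "g \<equiv> (1 / x - sqrt ((1 / x)\<^sup>2 + 4 / r\<^sup>2)) / 2 - 1 / r"
  shows "1 + r * g = (r + S) / (2 * x)" and "0 < r + S" and "0 < g" and "g < 1 / x"
    and "r = 1 / (1 / x - g) - 1 / g"
proof -
  have S_sq: "S\<^sup>2 = r\<^sup>2 + 4 * x\<^sup>2" by (simp add: S_def)
  have "2 * x < S" "- r < S"
    unfolding S_def using r x by (auto intro!: real_less_rsqrt simp: power_mult_distrib)
  have xr: "x * r < 0" using x r by (simp add: mult_pos_neg)
  then have den: "0 < 2 * (- (x * r))" by linarith
  have "S\<^sup>2 < (2 * x - r)\<^sup>2"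
    using xr unfolding S_sq by (simp add: power2_eq_square left_diff_distrib right_diff_distrib mult.commute[of r x])
  moreover have "0 \<le> 2 * x - r" using x r by simp
  ultimately have "S < 2 * x - r" by (rule power2_less_imp_less)
  \<comment> \<open>the two square roots are proportional; the sign of \<open>r\<close> enters through \<open>sqrt ((x * r)^2) = - (x * r)\<close>\<close>
  have "(1 / x)\<^sup>2 + 4 / r\<^sup>2 = (S / (- (x * r)))\<^sup>2"
    using x r by (simp add: power_divide power_mult_distrib S_sq field_simps)
  moreover have "0 \<le> S / (- (x * r))" using xr \<open>2 * x < S\<close> x by (intro divide_nonneg_pos) auto
  ultimately have "sqrt ((1 / x)\<^sup>2 + 4 / r\<^sup>2) = S / (- (x * r))"
    by (intro real_sqrt_unique) (rule sym)
  then have g: "g = (2 * x - (r + S)) / (2 * (- (x * r)))"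
    using x r unfolding g_def by (simp add: field_simps)
  show "1 + r * g = (r + S) / (2 * x)" using x r unfolding g by (simp add: field_simps)
  show "0 < r + S" using \<open>- r < S\<close> by simp
  show "0 < g" unfolding g using \<open>S < 2 * x - r\<close> by (intro divide_pos_pos[OF _ den]) simp
  have diff: "1 / x - g = (S - 2 * x - r) / (2 * (- (x * r)))"
    using x r unfolding g by (simp add: field_simps)
  have "0 < 1 / x - g" unfolding diff using \<open>2 * x < S\<close> r by (intro divide_pos_pos[OF _ den]) simp
  then show "g < 1 / x" by simp
  have ne: "S - 2 * x - r \<noteq> 0" "2 * x - (r + S) \<noteq> 0"
    using \<open>2 * x < S\<close> \<open>S < 2 * x - r\<close> r by auto
  have "1 / (1 / x - g) = 2 * (- (x * r)) / (S - 2 * x - r)"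
    unfolding diff by (simp only: divide_divide_eq_right mult_1)
  moreover have "1 / g = 2 * (- (x * r)) / (2 * x - (r + S))"
    unfolding g by (simp only: divide_divide_eq_right mult_1)
  ultimately have "1 / (1 / x - g) - 1 / g
      = (2 * (- (x * r)) * (2 * x - (r + S)) - 2 * (- (x * r)) * (S - 2 * x - r))
        / ((S - 2 * x - r) * (2 * x - (r + S)))"
    using ne by (simp only: diff_frac_eq not_False_eq_True)
  also have "\<dots> = r"
  proof -
    have "2 * (- (x * r)) * (2 * x - (r + S)) - 2 * (- (x * r)) * (S - 2 * x - r)
        = r * ((S - 2 * x - r) * (2 * x - (r + S)))"
      using S_sq by algebra
    then show ?thesis using ne by simp
  qed
  finally show "r = 1 / (1 / x - g) - 1 / g" ..
qed

lemma powm_phi_at_powm_h_neg_root: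
  fixes \<alpha> p v :: "real^'n" and r x g :: real
  assumes \<alpha>: "\<forall>i. 0 < \<alpha> $ i" and sum\<alpha>: "(\<Sum>i\<in>UNIV. \<alpha> $ i) = 1"
    and p: "\<And>i. 0 < p $ i" and x: "0 < x" and root: "powm_h_neg \<alpha> p r x = 0"
    and g: "1 + r * g = (r + sqrt (r\<^sup>2 + 4 * x\<^sup>2)) / (2 * x)" "0 < r + sqrt (r\<^sup>2 + 4 * x\<^sup>2)"
    and v: "\<And>i. v $ i = (1 + \<alpha> $ i * (1 + r * g)) / p $ i"
  shows "0 < v $ i" and "powm_phi \<alpha> v = 1 / x"
proof -
  have ap: "0 < \<alpha> $ i" for i using \<alpha> by blast
  have "0 < 1 + r * g" unfolding g(1) using g(2) x by simp
  then have v_pos: "0 < v $ i" for i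
    unfolding v using ap[of i] p[of i]
    by (intro divide_pos_pos add_pos_nonneg mult_nonneg_nonneg) auto
  then show "0 < v $ i" .
  have scale: "x * (v $ i / \<alpha> $ i) = x / (\<alpha> $ i * p $ i) + (r + sqrt (r\<^sup>2 + 4 * x\<^sup>2)) / (2 * p $ i)" for i
    unfolding v g(1) using ap[of i] p[of i] x by (simp add: field_simps)
  have "x * powm_phi \<alpha> v = 1"
    using powm_phi_scale[OF \<alpha> sum\<alpha> v_pos x] root unfolding scale powm_h_neg_def by simp
  then show "powm_phi \<alpha> v = 1 / x" using x by (simp add: field_simps)
qed

theorem theorem6:
  fixes \<alpha> p gp :: "real^'n" and r gr :: real
  assumes "\<forall>i. 0 < \<alpha> $ i"
    and "(\<Sum>i\<in>UNIV. \<alpha> $ i) = 1"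
    and "(p, r) \<in> interior (powm_cone \<alpha>)"
    and "(gp, gr) = primal_conj_grad (powm_dual_cone \<alpha>) (powm_dual_barrier \<alpha>) (p, r)"
  shows "(\<exists>!y. is_arg_max (conj_grad_objective (powm_dual_barrier \<alpha>) (p, r))
                 (\<lambda>y. y \<in> interior (powm_dual_cone \<alpha>)) y)
    \<and> (\<forall>i. gp $ i = - 1 / p $ i - \<alpha> $ i / p $ i * (1 + r * gr))
    \<and> (r > 0 \<longrightarrow>
         (\<exists>!x. x \<in> powm_h_pos_dom \<alpha> p r \<and> powm_h_pos \<alpha> p r x = 0) \<and>
         (\<forall>xh. xh \<in> powm_h_pos_dom \<alpha> p r \<and> powm_h_pos \<alpha> p r xh = 0 \<longrightarrow>
            gr = 1 / xh \<and>
            newton_converges_quadratically (powm_h_pos \<alpha> p r) (powm_h_pos_dom \<alpha> p r) 0 xh))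
    \<and> (r < 0 \<longrightarrow>
         (\<exists>!x. x \<in> powm_h_neg_dom \<alpha> p r \<and> powm_h_neg \<alpha> p r x = 0) \<and>
         (\<forall>xh. xh \<in> powm_h_neg_dom \<alpha> p r \<and> powm_h_neg \<alpha> p r xh = 0 \<longrightarrow>
            gr = (1 / xh - sqrt ((1 / xh)\<^sup>2 + 4 / r\<^sup>2)) / 2 - 1 / r \<and>
            newton_converges_quadratically (powm_h_neg \<alpha> p r) (powm_h_neg_dom \<alpha> p r)
              (\<Prod>i\<in>UNIV. (\<alpha> $ i * p $ i / (1 + \<alpha> $ i)) powr (\<alpha> $ i)) xh))
    \<and> (r = 0 \<longrightarrow>
         (\<forall>i. gp $ i = - 1 / p $ i - \<alpha> $ i / p $ i) \<and>
         gr = powm_phi \<alpha> (- gp) / 2)"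
proof -
  note \<alpha> = assms(1) and sum\<alpha> = assms(2)
  have ap: "0 < \<alpha> $ i" and p: "0 < p $ i" for i
    using \<alpha> interior_powm_coneD(1)[OF assms(3)] by auto
  have r_less: "r < (\<Prod>i\<in>UNIV. (p $ i) powr (\<alpha> $ i))"
    using interior_powm_coneD(2)[OF assms(3)] .
  define V where "V = (\<lambda>g. (\<chi> i. (1 + \<alpha> $ i * (1 + r * g)) / p $ i))"
  have V: "V g $ i = (1 + \<alpha> $ i * (1 + r * g)) / p $ i" for g i by (simp add: V_def)
  define unique_max where "unique_max \<longleftrightarrow> (\<exists>!y. is_arg_max (conj_grad_objective (powm_dual_barrier \<alpha>) (p, r))
                 (\<lambda>y. y \<in> interior (powm_dual_cone \<alpha>)) y)"
  have main: "unique_max \<and> gr = g \<and> gp = - V g"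
    if "\<And>i. 0 < V g $ i" "0 < g" "g < powm_phi \<alpha> (V g)" "r = 1 / (powm_phi \<alpha> (V g) - g) - 1 / g" for g
    using primal_conj_grad_powmI[OF \<alpha> sum\<alpha> p V that] assms(4) unfolding unique_max_def by simp
  have gp_eq: "gp $ i = - 1 / p $ i - \<alpha> $ i / p $ i * (1 + r * gr)" if "gp = - V gr" for i
    unfolding that using p[of i] by (simp add: V field_simps)
  consider "0 < r" | "r < 0" | "r = 0" by linarith
  then show ?thesis
  proof cases
    case 1
    obtain z where z: "z \<in> powm_h_pos_dom \<alpha> p r" "0 < z" "powm_h_pos \<alpha> p r z = 0"
      and uniq: "\<And>x. x \<in> powm_h_pos_dom \<alpha> p r \<Longrightarrow> powm_h_pos \<alpha> p r x = 0 \<Longrightarrow> x = z"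
      and newton: "newton_converges_quadratically (powm_h_pos \<alpha> p r) (powm_h_pos_dom \<alpha> p r) 0 z"
      using powm_h_pos_newton[OF \<alpha> sum\<alpha> p 1 r_less] by blast
    note root = powm_phi_at_powm_h_pos_root[OF \<alpha> sum\<alpha> p 1 z(2,3) V]
    have phi: "powm_phi \<alpha> (V (1 / z)) = 1 / z + 1 / (r + z)" by (rule root(2))
    have grad: "unique_max \<and> gr = 1 / z \<and> gp = - V (1 / z)"
    proof (rule main)
      show "0 < V (1 / z) $ i" for i by (rule root(1))
    qed (use z(2) 1 in \<open>simp_all add: phi\<close>)
    then have max: unique_max and gr: "gr = 1 / z" and gp: "gp = - V gr" by simp_all
    have gpi: "\<forall>i. gp $ i = - 1 / p $ i - \<alpha> $ i / p $ i * (1 + r * gr)"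
      using gp_eq[OF gp] by blast
    have ex1: "\<exists>!x. x \<in> powm_h_pos_dom \<alpha> p r \<and> powm_h_pos \<alpha> p r x = 0"
      using z uniq by blast
    have at_root: "\<forall>xh. xh \<in> powm_h_pos_dom \<alpha> p r \<and> powm_h_pos \<alpha> p r xh = 0 \<longrightarrow> gr = 1 / xh \<and>
        newton_converges_quadratically (powm_h_pos \<alpha> p r) (powm_h_pos_dom \<alpha> p r) 0 xh"
      using uniq gr newton by blast
    show ?thesis
      by (intro conjI impI; (rule max[unfolded unique_max_def] gpi ex1 at_root | use 1 in linarith))
  next
    case 2
    obtain z where z: "z \<in> powm_h_neg_dom \<alpha> p r" "0 < z" "powm_h_neg \<alpha> p r z = 0"
      and uniq: "\<And>x. x \<in> powm_h_neg_dom \<alpha> p r \<Longrightarrow> powm_h_neg \<alpha> p r x = 0 \<Longrightarrow> x = z"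
      and newton: "newton_converges_quadratically (powm_h_neg \<alpha> p r) (powm_h_neg_dom \<alpha> p r)
        (\<Prod>i\<in>UNIV. (\<alpha> $ i * p $ i / (1 + \<alpha> $ i)) powr (\<alpha> $ i)) z"
      using powm_h_neg_newton[OF \<alpha> sum\<alpha> p 2] by blast
    define g where "g = (1 / z - sqrt ((1 / z)\<^sup>2 + 4 / r\<^sup>2)) / 2 - 1 / r"
    note branch = negative_stationarity_branch[OF 2 z(2), folded g_def]
    note root = powm_phi_at_powm_h_neg_root[OF \<alpha> sum\<alpha> p z(2,3) branch(1,2) V]
    have phi: "powm_phi \<alpha> (V g) = 1 / z" by (rule root(2))
    have grad: "unique_max \<and> gr = g \<and> gp = - V g"
    proof (rule main)
      show "0 < V g $ i" for i by (rule root(1))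
    qed (unfold phi, (rule branch)+)
    then have max: unique_max and gr: "gr = g" and gp: "gp = - V gr" by simp_all
    have gpi: "\<forall>i. gp $ i = - 1 / p $ i - \<alpha> $ i / p $ i * (1 + r * gr)"
      using gp_eq[OF gp] by blast
    have ex1: "\<exists>!x. x \<in> powm_h_neg_dom \<alpha> p r \<and> powm_h_neg \<alpha> p r x = 0"
      using z uniq by blast
    have at_root: "\<forall>xh. xh \<in> powm_h_neg_dom \<alpha> p r \<and> powm_h_neg \<alpha> p r xh = 0 \<longrightarrow>
        gr = (1 / xh - sqrt ((1 / xh)\<^sup>2 + 4 / r\<^sup>2)) / 2 - 1 / r \<and>
        newton_converges_quadratically (powm_h_neg \<alpha> p r) (powm_h_neg_dom \<alpha> p r)
          (\<Prod>i\<in>UNIV. (\<alpha> $ i * p $ i / (1 + \<alpha> $ i)) powr (\<alpha> $ i)) xh"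
      using uniq gr[unfolded g_def] newton by blast
    show ?thesis
      by (intro conjI impI; (rule max[unfolded unique_max_def] gpi ex1 at_root | use 2 in linarith))
  next
    case 3
    define g where "g = powm_phi \<alpha> (V 0) / 2"
    have phi: "powm_phi \<alpha> (V g) = 2 * g" using 3 by (simp add: g_def V_def)
    have V_pos: "0 < V g $ i" for i
      unfolding V using ap[of i] p[of i] 3 by simp
    then have "0 < 2 * g" using \<alpha> by (simp add: powm_phi_eq_exp flip: phi)
    have grad: "unique_max \<and> gr = g \<and> gp = - V g"
    proof (rule main)
      show "0 < V g $ i" for i by (rule V_pos)
    qed (use \<open>0 < 2 * g\<close> in \<open>simp_all add: phi 3\<close>)
    then have max: unique_max and gr: "gr = g" and gp: "gp = - V gr" by simp_all
    have gpi: "\<forall>i. gp $ i = - 1 / p $ i - \<alpha> $ i / p $ i * (1 + r * gr)"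
      using gp_eq[OF gp] by blast
    then have gpi0: "\<forall>i. gp $ i = - 1 / p $ i - \<alpha> $ i / p $ i" using 3 by simp
    have gr0: "gr = powm_phi \<alpha> (- gp) / 2" by (simp add: gp gr phi)
    show ?thesis
      by (intro conjI impI; (rule max[unfolded unique_max_def] gpi gpi0 gr0 | use 3 in linarith))
  qed
qed

end
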